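(* Let $G$ be a connected graph of order $n$. For any two distinct vertices $u,v$ of $G$, order the vertices so that $u$ and $v$ come first and write $$L(G)+\frac1n\mathbb{J}=\begin{pmatrix} d_u+\frac1n & k & x^T\\ k & d_v+\frac1n & y^T\\ x & y & P\end{pmatrix},$$ where $k$ is a scalar, $x,y$ are column vectors and $P$ is a square matrix of order $n-2$ (all depending on $u,v$). Suppose that $P$ is invertible for each such pair. Then $G$ is resistance regular if and only if, for all distinct vertices $u,v$, $$d_v-d_u=y^TP^{-1}y-x^TP^{-1}x.$$
   Context: All graphs are finite, simple, undirected and connected. $d_i$ is the degree of vertex $i$; $L(G)=D-A$ is the Laplacian matrix ($D$ the diagonal degree matrix, $A$ the adjacency matrix); $\mathbb{J}$ is the $n\times n$ all-ones matrix. The resistance distance $r_{ij}$ is the effective resistance between vertices $i$ and $j$ when each edge of $G$ carries a unit resistance; equivalently (known fact) $r_{ij}=L_{ii}^++L_{jj}^+-2L_{ij}^+$, where $L^+$ is the Moore-Penrose inverse of $L(G)$. The resistance matrix is $R(G)=(r_{ij})$; $G$ is resistance regular if all row sums of $R(G)$ are equal. *)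

theory Defs
  imports
    "Graph_Theory.Digraph_Component"
    "Jordan_Normal_Form.Gauss_Jordan_Elimination"
begin

text \<open>
  A finite simple undirected graph is an element of the locale \<^locale>\<open>graph\<close>: a finite symmetric
  digraph without loops and parallel arcs.  Every undirected edge is thus a pair of opposite arcs,
  and the degree of a vertex is its out-degree.

  Matrices are taken with respect to an enumeration \<open>vs\<close> of the vertices without repetition.
\<close>

abbreviation degree :: "('a, 'b) pre_digraph \<Rightarrow> 'a \<Rightarrow> real" where
  "degree G v \<equiv> real (out_degree G v)"

definition adjacency_matrix :: "('a, 'b) pre_digraph \<Rightarrow> 'a list \<Rightarrow> real mat" where
  "adjacency_matrix G vs =
     mat (length vs) (length vs) (\<lambda>(i, j). if vs ! i \<rightarrow>\<^bsub>G\<^esub> vs ! j then 1 else 0)"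

definition degree_matrix :: "('a, 'b) pre_digraph \<Rightarrow> 'a list \<Rightarrow> real mat" where
  "degree_matrix G vs =
     mat (length vs) (length vs) (\<lambda>(i, j). if i = j then degree G (vs ! i) else 0)"

definition laplacian_matrix :: "('a, 'b) pre_digraph \<Rightarrow> 'a list \<Rightarrow> real mat" where
  "laplacian_matrix G vs = degree_matrix G vs - adjacency_matrix G vs"

definition all_ones_mat :: "nat \<Rightarrow> real mat" where
  "all_ones_mat n = mat n n (\<lambda>_. 1)"

text \<open>
  \<open>\<phi>\<close> is a potential that drives a unit current from \<open>u\<close> to \<open>v\<close> through the network in which every
  edge has resistance 1.  By Ohm's law the current along an arc \<open>e\<close> is
  \<open>\<phi> (tail G e) - \<phi> (head G e)\<close>; Kirchhoff's current law prescribes the net current out of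
  each vertex.
\<close>

definition unit_current_potential ::
    "('a, 'b) pre_digraph \<Rightarrow> 'a \<Rightarrow> 'a \<Rightarrow> ('a \<Rightarrow> real) \<Rightarrow> bool" where
  "unit_current_potential G u v \<phi> \<longleftrightarrow>
     (\<forall>w\<in>verts G. (\<Sum>e\<in>out_arcs G w. \<phi> (tail G e) - \<phi> (head G e)) =
        (if w = u then 1 else 0) - (if w = v then 1 else 0))"

text \<open>
  In a connected graph such a potential exists and is unique up to an additive constant, so the
  potential difference between \<open>u\<close> and \<open>v\<close> is well defined.
\<close>

definition resistance_distance :: "('a, 'b) pre_digraph \<Rightarrow> 'a \<Rightarrow> 'a \<Rightarrow> real" where
  "resistance_distance G u v =
     (THE r. \<exists>\<phi>. unit_current_potential G u v \<phi> \<and> r = \<phi> u - \<phi> v)"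

definition resistance_matrix :: "('a, 'b) pre_digraph \<Rightarrow> 'a list \<Rightarrow> real mat" where
  "resistance_matrix G vs =
     mat (length vs) (length vs) (\<lambda>(i, j). resistance_distance G (vs ! i) (vs ! j))"

definition resistance_regular :: "('a, 'b) pre_digraph \<Rightarrow> bool" where
  "resistance_regular G \<longleftrightarrow>
     (\<forall>vs. distinct vs \<and> set vs = verts G \<longrightarrow>
       (\<exists>c. \<forall>i<length vs. (\<Sum>j<length vs. resistance_matrix G vs $$ (i, j)) = c))"

text \<open>
  \<open>block_form G u v ws k x y P\<close>: with the vertices ordered as \<open>u, v\<close> followed by \<open>ws\<close>, the matrix
  \<open>L(G) + J/n\<close> has the block form with upper left block
  \<open>((d\<^sub>u + 1/n, k), (k, d\<^sub>v + 1/n))\<close>, upper right block with rows \<open>x\<close> and \<open>y\<close>, lower left block with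
  columns \<open>x\<close> and \<open>y\<close>, and lower right block \<open>P\<close>.
\<close>

definition block_form ::
    "('a, 'b) pre_digraph \<Rightarrow> 'a \<Rightarrow> 'a \<Rightarrow> 'a list \<Rightarrow> real \<Rightarrow> real vec \<Rightarrow> real vec \<Rightarrow> real mat \<Rightarrow> bool" where
  "block_form G u v ws k x y P \<longleftrightarrow>
     (let n = card (verts G); vs = u # v # ws in
       distinct vs \<and> set vs = verts G \<and>
       x \<in> carrier_vec (n - 2) \<and> y \<in> carrier_vec (n - 2) \<and> P \<in> carrier_mat (n - 2) (n - 2) \<and>
       laplacian_matrix G vs + (1 / real n) \<cdot>\<^sub>m all_ones_mat n =
         four_block_mat
           (mat_of_rows_list 2 [[degree G u + 1 / real n, k], [k, degree G v + 1 / real n]])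
           (mat_of_rows (n - 2) [x, y])
           (mat_of_cols (n - 2) [x, y])
           P)"

text \<open>Every ordering that starts with \<open>u, v\<close> has such a block form.\<close>

lemma block_form_exists:
  assumes "graph G" and "distinct (u # v # ws)" and "set (u # v # ws) = verts G"
  shows "\<exists>k x y P. block_form G u v ws k x y P"
proof -
  interpret graph G by fact
  let ?vs = "u # v # ws" and ?n = "card (verts G)"
  have n: "?n = Suc (Suc (length ws))"
    using distinct_card[OF assms(2)] assms(3) by simp
  let ?M = "laplacian_matrix G ?vs + (1 / real ?n) \<cdot>\<^sub>m all_ones_mat ?n"
  have sym: "a \<rightarrow>\<^bsub>G\<^esub> b \<longleftrightarrow> b \<rightarrow>\<^bsub>G\<^esub> a" for a b
    using sym_arcs by (auto simp: symmetric_def sym_def)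
  have irr: "\<not> a \<rightarrow>\<^bsub>G\<^esub> a" for a
    using no_loops by (auto simp: arcs_ends_def arc_to_ends_def)
  have M: "?M $$ (i, j) = (if i = j then degree G (?vs ! i) else 0)
      - (if ?vs ! i \<rightarrow>\<^bsub>G\<^esub> ?vs ! j then 1 else 0) + 1 / real ?n"
    if "i < ?n" "j < ?n" for i j
    using that by (simp add: n laplacian_matrix_def degree_matrix_def adjacency_matrix_def
        all_ones_mat_def)
  have M_sym: "?M $$ (i, j) = ?M $$ (j, i)" if "i < ?n" "j < ?n" for i j
    using M[OF that] M[OF that(2,1)] sym by auto
  have dim: "dim_row ?M = ?n" "dim_col ?M = ?n"
    by (auto simp: all_ones_mat_def)
  define k where "k = ?M $$ (0, 1)"
  define x where "x = vec (?n - 2) (\<lambda>i. ?M $$ (i + 2, 0))"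
  define y where "y = vec (?n - 2) (\<lambda>i. ?M $$ (i + 2, 1))"
  define P where "P = mat (?n - 2) (?n - 2) (\<lambda>(i, j). ?M $$ (i + 2, j + 2))"
  let ?B = "four_block_mat
      (mat_of_rows_list 2 [[degree G u + 1 / real ?n, k], [k, degree G v + 1 / real ?n]])
      (mat_of_rows (?n - 2) [x, y]) (mat_of_cols (?n - 2) [x, y]) P"
  have "?M = ?B"
  proof (rule eq_matI)
    show "dim_row ?M = dim_row ?B" "dim_col ?M = dim_col ?B"
      unfolding dim by (auto simp: n P_def mat_of_rows_list_def)
    fix i j assume "i < dim_row ?B" "j < dim_col ?B"
    then have ij: "i < ?n" "j < ?n"
      by (auto simp: n P_def mat_of_rows_list_def)
    have B: "?B $$ (i, j) =
        (if i < 2 then if j < 2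
           then [[degree G u + 1 / real ?n, k], [k, degree G v + 1 / real ?n]] ! i ! j
           else [x, y] ! i $ (j - 2)
         else if j < 2 then [x, y] ! j $ (i - 2) else P $$ (i - 2, j - 2))"
      using ij unfolding four_block_mat_def
      by (auto simp: n P_def mat_of_rows_list_def mat_of_rows_def mat_of_cols_def numeral_2_eq_2)
    have c: "i = 0 \<or> i = 1 \<or> 2 \<le> i" "j = 0 \<or> j = 1 \<or> 2 \<le> j" by auto
    have d: "?M $$ (0, 0) = degree G u + 1 / real ?n" "?M $$ (1, 1) = degree G v + 1 / real ?n"
      using M[of 0 0] M[of 1 1] irr by (auto simp: n)
    have kk: "?M $$ (1, 0) = k" using M_sym[of 1 0] by (simp add: n k_def)
    have s: "Suc (Suc (l - 2)) = l" if "2 \<le> l" for l :: nat using that by simp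
    have xx: "x $ (l - 2) = ?M $$ (l, 0)" "y $ (l - 2) = ?M $$ (l, 1)" if "2 \<le> l" "l < ?n" for l
      using that by (auto simp: x_def y_def s simp del: index_add_mat index_smult_mat)
    have PP: "P $$ (i - 2, j - 2) = ?M $$ (i, j)" if "2 \<le> i" "2 \<le> j"
      using that ij by (auto simp: P_def s simp del: index_add_mat index_smult_mat)
    have x': "x $ (j - 2) = ?M $$ (0, j)" "y $ (j - 2) = ?M $$ (1, j)" if "2 \<le> j"
      using xx[OF that ij(2)] M_sym[of 0 j] M_sym[of 1 j] ij by (auto simp: n simp del: index_add_mat index_smult_mat)
    show "?M $$ (i, j) = ?B $$ (i, j)"
      unfolding B using c
      by (elim disjE) (use d kk x' xx(1)[of i] xx(2)[of i] PP ij in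
          \<open>simp_all add: k_def del: index_add_mat index_smult_mat\<close>)
  qed
  then have "block_form G u v ws k x y P"
    using assms(2,3) unfolding block_form_def Let_def
    by (simp add: x_def y_def P_def)
  then show ?thesis by blast
qed

end

theory Submission
  imports "Jordan_Normal_Form.Determinant" Defs
begin

text \<open>
  The matrix \<open>M = L + J/n\<close> is invertible, and its inverse \<open>X\<close> is symmetric with row sums 1.  The
  difference of two columns of \<open>X\<close> is a unit current potential, so \<open>r\<^sub>u\<^sub>v = X\<^sub>u\<^sub>u + X\<^sub>v\<^sub>v - 2 X\<^sub>u\<^sub>v\<close> and
  row \<open>u\<close> of the resistance matrix has sum \<open>n X\<^sub>u\<^sub>u + tr X - 2\<close>.  Hence \<open>G\<close> is resistance regular
  iff \<open>X\<close> has constant diagonal.  The block of \<open>X\<close> at \<open>u, v\<close> is the inverse of the Schur complement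
  of \<open>P\<close> in \<open>M\<close>, and inverting a \<open>2 \<times> 2\<close> matrix swaps its diagonal entries up to the factor
  \<open>1 / det\<close>; so \<open>X\<^sub>u\<^sub>u = X\<^sub>v\<^sub>v\<close> iff
  \<open>d\<^sub>u - x\<^sup>TP\<^sup>-\<^sup>1x = d\<^sub>v - y\<^sup>TP\<^sup>-\<^sup>1y\<close>.
\<close>

section \<open>The Laplacian as an operator on functions of the vertices\<close>

definition net_outflow :: "('a, 'b) pre_digraph \<Rightarrow> ('a \<Rightarrow> real) \<Rightarrow> 'a \<Rightarrow> real" where
  "net_outflow G f w = (\<Sum>e\<in>out_arcs G w. f (tail G e) - f (head G e))"

text \<open>The action of \<open>L + J/n\<close> on functions, which needs no ordering of the
  vertices. Orderings enter only for the determinant argument and for reading off block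
  forms.\<close>

definition shifted_laplacian :: "('a, 'b) pre_digraph \<Rightarrow> ('a \<Rightarrow> real) \<Rightarrow> 'a \<Rightarrow> real" where
  "shifted_laplacian G f w = net_outflow G f w + (\<Sum>z\<in>verts G. f z) / real (card (verts G))"

definition shifted_laplacian_matrix :: "('a, 'b) pre_digraph \<Rightarrow> 'a list \<Rightarrow> real mat" where
  "shifted_laplacian_matrix G vs =
     laplacian_matrix G vs + (1 / real (length vs)) \<cdot>\<^sub>m all_ones_mat (length vs)"

lemma net_outflow_diff:
  "net_outflow G (\<lambda>w. f w - g w) w = net_outflow G f w - net_outflow G g w"
  by (simp add: net_outflow_def algebra_simps flip: sum_subtractf)

lemma unit_current_potential_iff:
  "unit_current_potential G u v \<phi> \<longleftrightarrow>
    (\<forall>w\<in>verts G. net_outflow G \<phi> w = (if w = u then 1 else 0) - (if w = v then 1 else 0))"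
  by (simp only: unit_current_potential_def net_outflow_def)

section \<open>Linear algebra: inverses and the Schur complement\<close>

lemma sum_nth_distinct:
  assumes "distinct vs"
  shows "(\<Sum>i<length vs. h (vs ! i)) = sum h (set vs)"
  using sum.reindex_bij_betw[OF bij_betw_nth[OF assms refl refl]] .

text \<open>A two-sided inverse makes \<open>A\<close> a unit of the matrix ring, which rules out
  the result \<open>None\<close> of \<open>mat_inverse\<close>.\<close>

lemma mat_inverse_invertible:
  fixes A :: "'a :: field mat"
  assumes A: "A \<in> carrier_mat n n" and "invertible_mat A"
  shows "the (mat_inverse A) \<in> carrier_mat n n" and "the (mat_inverse A) * A = 1\<^sub>m n"
proof -
  obtain B where B: "A * B = 1\<^sub>m n" "B * A = 1\<^sub>m (dim_row B)"
    using assms unfolding invertible_mat_def inverts_mat_def by auto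
  \<comment> \<open>\<open>invertible_mat\<close> does not fix the shape of \<open>B\<close>; it is
    recovered by comparing dimensions in the two product equations.\<close>
  have "dim_row B = n"
    using arg_cong[OF B(2), of dim_col] A by simp
  moreover have "dim_col B = n"
    using arg_cong[OF B(1), of dim_col] by simp
  ultimately have "A \<in> Units (ring_mat TYPE('a) n ())"
    using A B by (auto simp: Units_def ring_mat_simps intro!: exI[of _ B])
  then obtain C where "mat_inverse A = Some C"
    using mat_inverse(1)[OF A, of "()"] by (cases "mat_inverse A") auto
  with mat_inverse(2)[OF A this] show "the (mat_inverse A) \<in> carrier_mat n n"
    "the (mat_inverse A) * A = 1\<^sub>m n" by auto
qed

text \<open>Here \<open>D\<close> is the determinant of the symmetric matrix with rows
  \<open>(p, q)\<close> and \<open>(q, r)\<close>, and Cramer's rule gives \<open>a * D = r\<close>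
  and \<open>c * D = p\<close>. Keeping \<open>b\<close> and \<open>b'\<close> apart avoids a proof
  that the Schur complement is symmetric.\<close>

lemma symmetric_inverse_diag_eq_iff:
  fixes a b b' c p q r :: "'a :: field"
  assumes "a * p + b * q = 1" "b' * p + c * q = 0" "a * q + b * r = 0" "b' * q + c * r = 1"
  shows "p = r \<longleftrightarrow> a = c"
proof -
  define D where "D = p * r - q * q"
  have "a * D = (a * p + b * q) * r - q * (a * q + b * r)"
    "b * D = p * (a * q + b * r) - q * (a * p + b * q)"
    "c * D = (b' * q + c * r) * p - q * (b' * p + c * q)"
    by (simp_all add: D_def algebra_simps)
  then have a: "a * D = r" and b: "b * D = - q" and c: "c * D = p"
    unfolding assms by simp_all
  \<comment> \<open>If \<open>D = 0\<close>, then \<open>p = q = r = 0\<close>, against the first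
    assumption.\<close>
  have "D \<noteq> 0"
    using a b c assms(1) by auto
  then show ?thesis
    using a c by auto
qed

text \<open>Block elimination: the bottom rows give \<open>z\<close> as minus the combination of
  \<open>Q x\<close> and \<open>Q y\<close> with coefficients \<open>p\<close> and \<open>q\<close>,
  and this is substituted into the first two rows.\<close>

lemma schur_complement_equations:
  fixes x y z :: "real vec"
  assumes P: "P \<in> carrier_mat m m" and Q: "Q \<in> carrier_mat m m" and QP: "Q * P = 1\<^sub>m m"
    and x: "x \<in> carrier_vec m" and y: "y \<in> carrier_vec m" and z: "z \<in> carrier_vec m"
    and top: "a * p + k * q + x \<bullet> z = s" and mid: "k * p + c * q + y \<bullet> z = t"
    and bot: "p \<cdot>\<^sub>v x + q \<cdot>\<^sub>v y + P *\<^sub>v z = 0\<^sub>v m"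
  shows "(a - x \<bullet> (Q *\<^sub>v x)) * p + (k - x \<bullet> (Q *\<^sub>v y)) * q = s"
    and "(k - y \<bullet> (Q *\<^sub>v x)) * p + (c - y \<bullet> (Q *\<^sub>v y)) * q = t"
proof -
  have "Q *\<^sub>v (p \<cdot>\<^sub>v x + q \<cdot>\<^sub>v y + P *\<^sub>v z) = p \<cdot>\<^sub>v (Q *\<^sub>v x) + q \<cdot>\<^sub>v (Q *\<^sub>v y) + z"
    using P Q QP x y z
    by (simp add: mult_add_distrib_mat_vec[of _ m m] assoc_add_vec[of _ m] mult_mat_vec[of _ m m]
        flip: assoc_mult_mat_vec[of _ m m _ m])
  moreover have "Q *\<^sub>v 0\<^sub>v m = 0\<^sub>v m"
    using Q by (intro eq_vecI) auto
  ultimately have eq: "p \<cdot>\<^sub>v (Q *\<^sub>v x) + q \<cdot>\<^sub>v (Q *\<^sub>v y) + z = 0\<^sub>v m"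
    by (simp add: bot)
  \<comment> \<open>Pairing with \<open>w = x\<close> and \<open>w = y\<close> expresses the two
    products with \<open>z\<close> that have to be eliminated.\<close>
  have "p * (w \<bullet> (Q *\<^sub>v x)) + q * (w \<bullet> (Q *\<^sub>v y)) + w \<bullet> z = 0" if w: "w \<in> carrier_vec m" for w
    using arg_cong[OF eq, of "\<lambda>v. w \<bullet> v"] w x y z Q
    by (simp add: scalar_prod_add_distrib[of _ m])
  from this[OF x] this[OF y] top mid
  show "(a - x \<bullet> (Q *\<^sub>v x)) * p + (k - x \<bullet> (Q *\<^sub>v y)) * q = s"
    "(k - y \<bullet> (Q *\<^sub>v x)) * p + (c - y \<bullet> (Q *\<^sub>v y)) * q = t"
    by (simp_all add: algebra_simps)
qed

section \<open>Green's identity and the kernel of the Laplacian\<close>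

context graph begin

text \<open>Absence of parallel arcs makes \<open>head G\<close> injective here, so sums over
  outgoing arcs become sums over adjacent vertices.\<close>

lemma bij_betw_head_out_arcs: "bij_betw (head G) (out_arcs G w) {z \<in> verts G. w \<rightarrow>\<^bsub>G\<^esub> z}"
  unfolding bij_betw_def
proof
  show "inj_on (head G) (out_arcs G w)"
    by (intro inj_onI no_multi_arcs) (auto simp: arc_to_ends_def)
  show "head G ` out_arcs G w = {z \<in> verts G. w \<rightarrow>\<^bsub>G\<^esub> z}"
    by (auto simp: arcs_ends_conv image_iff out_arcs_def)
qed

lemma sum_head_out_arcs:
  "(\<Sum>e\<in>out_arcs G w. h (head G e)) =
    (\<Sum>z\<in>verts G. if w \<rightarrow>\<^bsub>G\<^esub> z then h z else (0 :: real))"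
  using sum.reindex_bij_betw[OF bij_betw_head_out_arcs, of h w]
  by (simp add: sum.inter_filter)

lemma net_outflow_eq:
  "net_outflow G f w = (\<Sum>z\<in>verts G. if w \<rightarrow>\<^bsub>G\<^esub> z then f w - f z else 0)"
proof -
  have "net_outflow G f w = (\<Sum>e\<in>out_arcs G w. f w - f (head G e))"
    unfolding net_outflow_def by (rule sum.cong) auto
  then show ?thesis
    using sum_head_out_arcs[of "\<lambda>z. f w - f z" w] by simp
qed

lemma out_degree_eq: "degree G w = (\<Sum>z\<in>verts G. if w \<rightarrow>\<^bsub>G\<^esub> z then 1 else 0)"
  using sum_head_out_arcs[of "\<lambda>_. 1" w] by (simp add: out_degree_def)

lemma adj_commute: "w \<rightarrow>\<^bsub>G\<^esub> z \<longleftrightarrow> z \<rightarrow>\<^bsub>G\<^esub> w"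
  using sym_arcs by (auto simp: symmetric_def sym_def)

text \<open>Summation by parts. The factor 2 arises because every edge occurs in both directions in
  the double sum.\<close>

lemma greens_identity:
  "2 * (\<Sum>w\<in>verts G. g w * net_outflow G f w) =
     (\<Sum>w\<in>verts G. \<Sum>z\<in>verts G. if w \<rightarrow>\<^bsub>G\<^esub> z then (g w - g z) * (f w - f z) else 0)"
proof -
  let ?S = "\<lambda>h. \<Sum>w\<in>verts G. \<Sum>z\<in>verts G. if w \<rightarrow>\<^bsub>G\<^esub> z then h w z else (0 :: real)"
  have 1: "(\<Sum>w\<in>verts G. g w * net_outflow G f w) = ?S (\<lambda>w z. g w * (f w - f z))"
    by (auto simp: net_outflow_eq sum_distrib_left intro!: sum.cong)
  \<comment> \<open>Exchanging the names of \<open>w\<close> and \<open>z\<close> is harmless since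
    adjacency is symmetric.\<close>
  have 2: "\<dots> = ?S (\<lambda>w z. g z * (f z - f w))"
    by (subst sum.swap) (auto simp: adj_commute intro!: sum.cong)
  have "2 * (\<Sum>w\<in>verts G. g w * net_outflow G f w) =
      ?S (\<lambda>w z. g w * (f w - f z)) + ?S (\<lambda>w z. g z * (f z - f w))"
    using 1 2 by simp
  also have "\<dots> = ?S (\<lambda>w z. (g w - g z) * (f w - f z))"
    unfolding sum.distrib[symmetric] by (auto simp: algebra_simps intro!: sum.cong)
  finally show ?thesis .
qed

lemma net_outflow_self_adjoint:
  "(\<Sum>w\<in>verts G. g w * net_outflow G f w) = (\<Sum>w\<in>verts G. f w * net_outflow G g w)"
  using greens_identity[of g f] greens_identity[of f g]
  by (simp add: mult.commute cong: if_cong)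

lemma sum_net_outflow: "(\<Sum>w\<in>verts G. net_outflow G f w) = 0"
  using greens_identity[of "\<lambda>_. 1" f] by (simp cong: if_cong)

text \<open>With both arguments equal to \<open>f\<close>, Green's identity is a vanishing sum of
  squares, so \<open>f\<close> agrees across each edge and hence along each path.\<close>

lemma net_outflow_zero_imp_constant:
  assumes "Digraph_Component.connected G" and zero: "\<forall>w\<in>verts G. net_outflow G f w = 0"
    and "u \<in> verts G" "v \<in> verts G"
  shows "f u = f v"
proof -
  have "(\<Sum>w\<in>verts G. \<Sum>z\<in>verts G. if w \<rightarrow>\<^bsub>G\<^esub> z then (f w - f z) * (f w - f z) else 0) = 0"
    using greens_identity[of f f] zero by simp
  then have "\<forall>w\<in>verts G. \<forall>z\<in>verts G. w \<rightarrow>\<^bsub>G\<^esub> z \<longrightarrow> f w = f z"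
    by (simp add: sum_nonneg_eq_0_iff sum_nonneg) (metis mult_eq_0_iff right_minus_eq)
  then have edge: "f w = f z" if "w \<rightarrow>\<^bsub>G\<^esub> z" for w z
    using that adj_in_verts by blast
  have "u \<rightarrow>\<^sup>*\<^bsub>G\<^esub> v"
    using symmetric_connected_imp_strongly_connected[OF sym_arcs assms(1)] assms(3,4)
    by (auto simp: strongly_connected_def)
  then show ?thesis
    by (induction rule: reachable_induct) (use edge in auto)
qed

section \<open>Invertibility of the shifted Laplacian\<close>

lemma sum_shifted_laplacian: "(\<Sum>w\<in>verts G. shifted_laplacian G f w) = (\<Sum>w\<in>verts G. f w)"
proof (cases "verts G = {}")
  case False
  then show ?thesis
    by (simp add: shifted_laplacian_def sum.distrib sum_net_outflow)
qed simp

lemma shifted_laplacian_self_adjoint: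
  "(\<Sum>w\<in>verts G. g w * shifted_laplacian G f w) = (\<Sum>w\<in>verts G. f w * shifted_laplacian G g w)"
proof -
  have "(\<Sum>w\<in>verts G. g w * shifted_laplacian G f w) = (\<Sum>w\<in>verts G. g w * net_outflow G f w)
      + (\<Sum>w\<in>verts G. g w) * ((\<Sum>z\<in>verts G. f z) / real (card (verts G)))" for f g
    unfolding shifted_laplacian_def sum_distrib_right sum.distrib[symmetric] distrib_left ..
  then show ?thesis
    using net_outflow_self_adjoint[of g f] by simp
qed

text \<open>The total of \<open>f\<close> is preserved, hence 0, so the \<open>J/n\<close> term
  drops out and \<open>f\<close> lies in the kernel of \<open>L\<close>. A constant function with
  total 0 vanishes.\<close>

lemma shifted_laplacian_injective:
  assumes "Digraph_Component.connected G" and zero: "\<forall>w\<in>verts G. shifted_laplacian G f w = 0"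
    and u: "u \<in> verts G"
  shows "f u = 0"
proof -
  have s: "(\<Sum>w\<in>verts G. f w) = 0"
    using sum_shifted_laplacian[of f] zero by simp
  then have "\<forall>w\<in>verts G. net_outflow G f w = 0"
    using zero by (simp add: shifted_laplacian_def)
  then have "\<forall>w\<in>verts G. f w = f u"
    using net_outflow_zero_imp_constant[OF assms(1)] u by blast
  then have "(\<Sum>w\<in>verts G. f w) = (\<Sum>w\<in>verts G. f u)"
    by (intro sum.cong) auto
  then have "real (card (verts G)) * f u = 0"
    using s by simp
  then show ?thesis
    using u by auto
qed

lemma shifted_laplacian_matrix_mult_vec:
  assumes vs: "distinct vs" "set vs = verts G" and i: "i < length vs"
  shows "(shifted_laplacian_matrix G vs *\<^sub>v vec (length vs) (\<lambda>j. f (vs ! j))) $ i =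
    shifted_laplacian G f (vs ! i)"
proof -
  let ?n = "length vs" and ?w = "vs ! i"
  have n: "card (verts G) = ?n"
    using distinct_card[OF vs(1)] vs(2) by simp
  have w: "?w \<in> verts G"
    using nth_mem[OF i] vs(2) by simp
  have entry: "shifted_laplacian_matrix G vs $$ (i, j) = (if ?w = vs ! j then degree G ?w else 0)
      - (if ?w \<rightarrow>\<^bsub>G\<^esub> vs ! j then 1 else 0) + 1 / real ?n" if "j < ?n" for j
    using i that nth_eq_iff_index_eq[OF vs(1) i that]
    by (simp add: shifted_laplacian_matrix_def laplacian_matrix_def degree_matrix_def
        adjacency_matrix_def all_ones_mat_def)
  have dim: "dim_row (shifted_laplacian_matrix G vs) = ?n"
      "dim_col (shifted_laplacian_matrix G vs) = ?n"
    by (simp_all add: shifted_laplacian_matrix_def all_ones_mat_def)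
  define h where "h z = ((if ?w = z then degree G ?w else 0)
      - (if ?w \<rightarrow>\<^bsub>G\<^esub> z then 1 else 0) + 1 / real ?n) * f z" for z
  have "(shifted_laplacian_matrix G vs *\<^sub>v vec ?n (\<lambda>j. f (vs ! j))) $ i =
      (\<Sum>j<?n. h (vs ! j))"
    using i by (simp add: dim scalar_prod_def atLeast0LessThan entry h_def)
  also have "\<dots> = (\<Sum>z\<in>verts G. h z)"
    by (simp only: sum_nth_distinct[OF vs(1), of h] vs(2))
  also have "\<dots> = (\<Sum>z\<in>verts G. if ?w = z then degree G ?w * f z else 0)
      - (\<Sum>z\<in>verts G. if ?w \<rightarrow>\<^bsub>G\<^esub> z then f z else 0) + (\<Sum>z\<in>verts G. f z) / real ?n"
    unfolding sum.distrib[symmetric] sum_subtractf[symmetric] sum_divide_distrib h_def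
    by (intro sum.cong) (auto simp: algebra_simps)
  also have "(\<Sum>z\<in>verts G. if ?w = z then degree G ?w * f z else 0) = degree G ?w * f ?w"
    using w by simp
  also have "\<dots> = (\<Sum>z\<in>verts G. if ?w \<rightarrow>\<^bsub>G\<^esub> z then f ?w else 0)"
    by (auto simp: out_degree_eq sum_distrib_right intro!: sum.cong)
  also have "\<dots> - (\<Sum>z\<in>verts G. if ?w \<rightarrow>\<^bsub>G\<^esub> z then f z else 0) = net_outflow G f ?w"
    unfolding net_outflow_eq sum_subtractf[symmetric] by (intro sum.cong) auto
  finally show ?thesis
    by (simp add: shifted_laplacian_def n)
qed

text \<open>In finite dimension injectivity forces a nonzero determinant, and an inverse matrix then
  supplies preimages.\<close>

lemma shifted_laplacian_surjective:
  assumes "Digraph_Component.connected G"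
  shows "\<exists>f. \<forall>w\<in>verts G. shifted_laplacian G f w = h w"
proof -
  obtain vs where vs: "set vs = verts G" "distinct vs"
    using finite_distinct_list[OF finite_verts] by blast
  let ?n = "length vs" and ?M = "shifted_laplacian_matrix G vs"
  \<comment> \<open>Turns a coordinate vector into a function through the inverse of the
    enumeration; only its values on \<open>verts G\<close> matter.\<close>
  define to_fun where "to_fun a w = a $ (the_inv_into {..<?n} (\<lambda>i. vs ! i) w)" for a :: "real vec" and w
  have to_fun: "to_fun a (vs ! i) = a $ i" if "i < ?n" for a i
    using that vs(2) unfolding to_fun_def
    by (subst the_inv_into_f_f) (auto simp: inj_on_def nth_eq_iff_index_eq)
  have M: "?M \<in> carrier_mat ?n ?n"
    by (auto simp: shifted_laplacian_matrix_def all_ones_mat_def)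
  have app: "(?M *\<^sub>v a) $ i = shifted_laplacian G (to_fun a) (vs ! i)"
    if "i < ?n" "a \<in> carrier_vec ?n" for a i
  proof -
    have "a = vec ?n (\<lambda>j. to_fun a (vs ! j))"
      using that(2) by (intro eq_vecI) (auto simp: to_fun)
    then show ?thesis
      using shifted_laplacian_matrix_mult_vec[OF vs(2,1) that(1), of "to_fun a"] by simp
  qed
  have "a = 0\<^sub>v ?n" if a: "a \<in> carrier_vec ?n" "?M *\<^sub>v a = 0\<^sub>v ?n" for a
  proof -
    have "\<forall>w\<in>verts G. shifted_laplacian G (to_fun a) w = 0"
      using app[OF _ a(1)] a(2) by (metis in_set_conv_nth index_zero_vec(1) vs(1))
    then have "\<forall>w\<in>verts G. to_fun a w = 0"
      using shifted_laplacian_injective[OF assms] by blast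
    then show ?thesis
      using a(1) vs(1) to_fun by (intro eq_vecI) (auto, metis nth_mem)
  qed
  then have "det ?M \<noteq> 0"
    using det_0_iff_vec_prod_zero_field[OF M] by blast
  then obtain N where N: "N \<in> carrier_mat ?n ?n" "?M * N = 1\<^sub>m ?n"
    using det_non_zero_imp_unit[OF M, of "()"] by (auto simp: Units_def ring_mat_simps)
  define b where "b = vec ?n (\<lambda>i. h (vs ! i))"
  have "?M *\<^sub>v (N *\<^sub>v b) = b"
    using N M by (simp add: b_def flip: assoc_mult_mat_vec[of _ ?n ?n _ ?n])
  moreover have "N *\<^sub>v b \<in> carrier_vec ?n"
    using N by (simp add: b_def)
  ultimately have "shifted_laplacian G (to_fun (N *\<^sub>v b)) (vs ! i) = h (vs ! i)" if "i < ?n" for i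
    using app[of i "N *\<^sub>v b"] that by (simp add: b_def)
  then show ?thesis
    by (metis in_set_conv_nth vs(1))
qed

section \<open>Resistance distance and row sums\<close>

lemma unit_current_potential_unique:
  assumes "Digraph_Component.connected G" and "u \<in> verts G" "v \<in> verts G"
    and "unit_current_potential G u v \<phi>" "unit_current_potential G u v \<psi>"
  shows "\<phi> u - \<phi> v = \<psi> u - \<psi> v"
proof -
  have "\<forall>w\<in>verts G. net_outflow G (\<lambda>w. \<phi> w - \<psi> w) w = 0"
    using assms(4,5) by (simp add: unit_current_potential_iff net_outflow_diff)
  from net_outflow_zero_imp_constant[OF assms(1) this assms(2,3)] show ?thesis
    by simp
qed

lemma resistance_distance_eqI:
  assumes "Digraph_Component.connected G" and "u \<in> verts G" "v \<in> verts G"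
    and "unit_current_potential G u v \<phi>"
  shows "resistance_distance G u v = \<phi> u - \<phi> v"
  unfolding resistance_distance_def
  using unit_current_potential_unique[OF assms(1-3)] assms(4) by (intro the_equality) blast+

lemma resistance_regular_iff:
  "resistance_regular G \<longleftrightarrow>
    (\<exists>c. \<forall>u\<in>verts G. (\<Sum>w\<in>verts G. resistance_distance G u w) = c)"
proof -
  have "(\<exists>c. \<forall>i<length vs. (\<Sum>j<length vs. resistance_matrix G vs $$ (i, j)) = c) \<longleftrightarrow>
      (\<exists>c. \<forall>u\<in>verts G. (\<Sum>w\<in>verts G. resistance_distance G u w) = c)"
    if vs: "distinct vs" "set vs = verts G" for vs
  proof -
    have row: "(\<Sum>j<length vs. resistance_matrix G vs $$ (i, j)) =
        (\<Sum>w\<in>verts G. resistance_distance G (vs ! i) w)" if "i < length vs" for i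
      using that sum_nth_distinct[OF vs(1), of "resistance_distance G (vs ! i)"] vs(2)
      by (simp add: resistance_matrix_def)
    show ?thesis
      unfolding all_set_conv_all_nth[of vs, unfolded vs(2)] by (simp only: row cong: all_cong)
  qed
  \<comment> \<open>Some ordering exists, so the quantifier over orderings in
    \<open>resistance_regular\<close> is not vacuous.\<close>
  moreover obtain vs where "set vs = verts G" "distinct vs"
    using finite_distinct_list[OF finite_verts] by blast
  ultimately show ?thesis
    unfolding resistance_regular_def by blast
qed

end

text \<open>\<open>g u\<close> is the column of \<open>(L + J/n)\<^sup>-\<^sup>1\<close> that belongs to \<open>u\<close>.\<close>

locale green_function = graph G for G :: "('a, 'b) pre_digraph" +
  fixes g :: "'a \<Rightarrow> 'a \<Rightarrow> real"
  assumes connected: "Digraph_Component.connected G"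
    and shifted_laplacian_g: "u \<in> verts G \<Longrightarrow> w \<in> verts G \<Longrightarrow>
      shifted_laplacian G (g u) w = (if w = u then 1 else 0)"
begin

section \<open>Resistances in terms of the Green function\<close>

text \<open>Pairing any \<open>f\<close> with the shifted Laplacian of \<open>g z\<close> evaluates
  \<open>f\<close> at \<open>z\<close>; self-adjointness then swaps \<open>u\<close> and
  \<open>v\<close>.\<close>

lemma green_commute:
  assumes "u \<in> verts G" "v \<in> verts G"
  shows "g u v = g v u"
proof -
  have "(\<Sum>w\<in>verts G. f w * shifted_laplacian G (g z) w) = f z" if "z \<in> verts G" for f z
  proof -
    have "(\<Sum>w\<in>verts G. f w * shifted_laplacian G (g z) w) = (\<Sum>w\<in>verts G. if w = z then f w else 0)"
      using that by (intro sum.cong) (auto simp: shifted_laplacian_g)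
    then show ?thesis
      using that by simp
  qed
  then show ?thesis
    using shifted_laplacian_self_adjoint[of "g u" "g v"] assms by simp
qed

lemma sum_green: "u \<in> verts G \<Longrightarrow> (\<Sum>w\<in>verts G. g u w) = 1"
  using sum_shifted_laplacian[of "g u"] by (simp add: shifted_laplacian_g)

lemma resistance_distance_green:
  assumes "u \<in> verts G" "v \<in> verts G"
  shows "resistance_distance G u v = g u u + g v v - 2 * g u v"
proof -
  have "net_outflow G (\<lambda>w. g u w - g v w) w = (if w = u then 1 else 0) - (if w = v then 1 else 0)"
    if w: "w \<in> verts G" for w
  proof -
    \<comment> \<open>Both columns have total 1, so their \<open>J/n\<close> terms cancel.\<close>
    have "net_outflow G (\<lambda>w. g u w - g v w) w =
        shifted_laplacian G (g u) w - shifted_laplacian G (g v) w"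
      using assms by (simp add: net_outflow_diff shifted_laplacian_def sum_green)
    then show ?thesis
      using assms w by (simp add: shifted_laplacian_g)
  qed
  then have "unit_current_potential G u v (\<lambda>w. g u w - g v w)"
    by (simp add: unit_current_potential_iff)
  from resistance_distance_eqI[OF connected assms this] show ?thesis
    using green_commute[OF assms] by simp
qed

lemma sum_resistance_distance:
  assumes "u \<in> verts G"
  shows "(\<Sum>w\<in>verts G. resistance_distance G u w) =
    real (card (verts G)) * g u u + (\<Sum>w\<in>verts G. g w w) - 2"
proof -
  have "(\<Sum>w\<in>verts G. resistance_distance G u w) = (\<Sum>w\<in>verts G. g u u + g w w - 2 * g u w)"
    using assms by (intro sum.cong) (auto simp: resistance_distance_green)
  then show ?thesis
    using assms by (simp add: sum.distrib sum_subtractf sum_green flip: sum_distrib_left)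
qed

lemma resistance_regular_iff_green_diag:
  "resistance_regular G \<longleftrightarrow> (\<forall>u\<in>verts G. \<forall>v\<in>verts G. u \<noteq> v \<longrightarrow> g u u = g v v)"
proof (cases "verts G = {}")
  case False
  then have n: "real (card (verts G)) \<noteq> 0"
    by simp
  have "resistance_regular G \<longleftrightarrow> (\<forall>u\<in>verts G. \<forall>v\<in>verts G.
      (\<Sum>w\<in>verts G. resistance_distance G u w) = (\<Sum>w\<in>verts G. resistance_distance G v w))"
    unfolding resistance_regular_iff using False by metis
  also have "\<dots> \<longleftrightarrow> (\<forall>u\<in>verts G. \<forall>v\<in>verts G. g u u = g v v)"
    \<comment> \<open>The trace and the constant 2 are common to all row sums; the factor
      \<open>n\<close> cancels because the graph is nonempty.\<close>
    using n by (simp add: sum_resistance_distance)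
  finally show ?thesis
    by metis
qed (simp add: resistance_regular_iff)

section \<open>Block elimination for a column of the inverse\<close>

text \<open>The column \<open>g w\<close> solves the block system with a unit vector on the right.
  For \<open>w\<close> in \<open>{u, v}\<close> that vector vanishes on the rows of
  \<open>ws\<close>, as the elimination of \<open>z\<close> requires.\<close>

lemma block_form_schur:
  assumes B: "block_form G u v ws k x y P" and inv: "invertible_mat P"
    and w: "w \<in> {u, v}"
  defines "Q \<equiv> the (mat_inverse P)" and "n \<equiv> real (card (verts G))"
  shows "(degree G u + 1 / n - x \<bullet> (Q *\<^sub>v x)) * g w u + (k - x \<bullet> (Q *\<^sub>v y)) * g w v =
      (if u = w then 1 else 0)"
    and "(k - y \<bullet> (Q *\<^sub>v x)) * g w u + (degree G v + 1 / n - y \<bullet> (Q *\<^sub>v y)) * g w v =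
      (if v = w then 1 else 0)"
proof -
  let ?vs = "u # v # ws" and ?N = "card (verts G)" and ?m = "length ws" and ?f = "g w"
  have vs: "distinct ?vs" "set ?vs = verts G" and N: "?N = Suc (Suc ?m)"
    using B distinct_card[of ?vs] by (auto simp: block_form_def Let_def)
  have x: "x \<in> carrier_vec ?m" and y: "y \<in> carrier_vec ?m" and P: "P \<in> carrier_mat ?m ?m"
    using B by (auto simp: block_form_def Let_def N)
  have w': "w \<in> verts G"
    using w vs(2) by auto
  define z where "z = vec ?m (\<lambda>i. ?f (ws ! i))"
  define a where "a = vec 2 (\<lambda>i. ?f (?vs ! i))"
  define A where "A = mat_of_rows_list 2 [[degree G u + 1 / n, k], [k, degree G v + 1 / n]]"
  have z: "z \<in> carrier_vec ?m" and a: "a \<in> carrier_vec 2" and A: "A \<in> carrier_mat 2 2"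
    by (auto simp: z_def a_def A_def mat_of_rows_list_def)
  have R: "mat_of_rows ?m [x, y] \<in> carrier_mat 2 ?m" and C: "mat_of_cols ?m [x, y] \<in> carrier_mat ?m 2"
    by (auto simp: numeral_2_eq_2)
  have M: "shifted_laplacian_matrix G ?vs =
      four_block_mat A (mat_of_rows ?m [x, y]) (mat_of_cols ?m [x, y]) P"
    using B by (simp add: block_form_def Let_def N shifted_laplacian_matrix_def A_def n_def)
  \<comment> \<open>The column is cut after its entries at \<open>u\<close> and \<open>v\<close> to
    match the blocks.\<close>
  have split: "vec (length ?vs) (\<lambda>j. ?f (?vs ! j)) = a @\<^sub>v z"
    by (intro eq_vecI) (auto simp: a_def z_def append_vec_def nth_Cons' less_Suc_eq_0_disj)
  let ?t = "A *\<^sub>v a + mat_of_rows ?m [x, y] *\<^sub>v z"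
  let ?b = "mat_of_cols ?m [x, y] *\<^sub>v a + P *\<^sub>v z"
  have row: "(?t @\<^sub>v ?b) $ i = (if ?vs ! i = w then 1 else 0)" if "i < length ?vs" for i
    using shifted_laplacian_matrix_mult_vec[OF vs that, of ?f] that vs(2)
      shifted_laplacian_g[OF w', of "?vs ! i"] nth_mem[OF that]
    unfolding split M four_block_mat_mult_vec[OF A R C P a z] by simp
  have dim: "dim_vec ?t = 2" "dim_vec ?b = ?m"
    using P by auto
  have Aa: "(A *\<^sub>v a) $ 0 = (degree G u + 1 / n) * ?f u + k * ?f v"
    "(A *\<^sub>v a) $ Suc 0 = k * ?f u + (degree G v + 1 / n) * ?f v"
    by (simp_all add: A_def a_def mat_of_rows_list_def scalar_prod_def numeral_2_eq_2)
  have top: "(degree G u + 1 / n) * ?f u + k * ?f v + x \<bullet> z = (if u = w then 1 else 0)"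
    using row[of 0] x
    by (simp add: append_vec_def dim Aa)
  have mid: "k * ?f u + (degree G v + 1 / n) * ?f v + y \<bullet> z = (if v = w then 1 else 0)"
    using row[of 1] y
    by (simp add: append_vec_def dim Aa)
  have Ca: "mat_of_cols ?m [x, y] *\<^sub>v a = ?f u \<cdot>\<^sub>v x + ?f v \<cdot>\<^sub>v y"
    using x y
    by (intro eq_vecI) (auto simp: a_def mat_of_cols_def scalar_prod_def numeral_2_eq_2)
  have "?b $ i = 0" if i: "i < ?m" for i
  proof -
    have "ws ! i \<noteq> w"
      using nth_mem[OF i] vs(1) w by auto
    then show ?thesis
      using row[of "Suc (Suc i)"] i dim by (simp add: append_vec_def)
  qed
  then have bot: "?f u \<cdot>\<^sub>v x + ?f v \<cdot>\<^sub>v y + P *\<^sub>v z = 0\<^sub>v ?m"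
    unfolding Ca[symmetric] using dim by (intro eq_vecI) auto
  note Q = mat_inverse_invertible[OF P inv, folded Q_def]
  show "(degree G u + 1 / n - x \<bullet> (Q *\<^sub>v x)) * ?f u + (k - x \<bullet> (Q *\<^sub>v y)) * ?f v =
      (if u = w then 1 else 0)"
    and "(k - y \<bullet> (Q *\<^sub>v x)) * ?f u + (degree G v + 1 / n - y \<bullet> (Q *\<^sub>v y)) * ?f v =
      (if v = w then 1 else 0)"
    by (rule schur_complement_equations[OF P Q x y z top mid bot])+
qed

end

theorem theorem2p34:
  fixes G :: "('a, 'b) pre_digraph"
    and ws :: "'a \<Rightarrow> 'a \<Rightarrow> 'a list"
    and k :: "'a \<Rightarrow> 'a \<Rightarrow> real"
    and x y :: "'a \<Rightarrow> 'a \<Rightarrow> real vec"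
    and P :: "'a \<Rightarrow> 'a \<Rightarrow> real mat"
  assumes "graph G"
    and "Digraph_Component.connected G"
    and "\<forall>u\<in>verts G. \<forall>v\<in>verts G. u \<noteq> v \<longrightarrow>
           block_form G u v (ws u v) (k u v) (x u v) (y u v) (P u v)"
    and "\<forall>u\<in>verts G. \<forall>v\<in>verts G. u \<noteq> v \<longrightarrow> invertible_mat (P u v)"
  shows "resistance_regular G \<longleftrightarrow>
    (\<forall>u\<in>verts G. \<forall>v\<in>verts G. u \<noteq> v \<longrightarrow>
       degree G v - degree G u =
         y u v \<bullet> (the (mat_inverse (P u v)) *\<^sub>v y u v)
         - x u v \<bullet> (the (mat_inverse (P u v)) *\<^sub>v x u v))"
proof -
  interpret graph G by fact
  \<comment> \<open>Preimages of the indicator functions of single vertices are the columns of the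
    inverse.\<close>
  obtain g where g: "\<forall>u. \<forall>w\<in>verts G. shifted_laplacian G (g u) w = (if w = u then 1 else 0)"
    using choice[OF allI, OF shifted_laplacian_surjective[OF assms(2)],
        of "\<lambda>u w. if w = u then 1 else 0"] by blast
  interpret green_function G g
    by unfold_locales (use assms(2) g in auto)
  have "g u u = g v v \<longleftrightarrow> degree G v - degree G u =
      y u v \<bullet> (the (mat_inverse (P u v)) *\<^sub>v y u v)
      - x u v \<bullet> (the (mat_inverse (P u v)) *\<^sub>v x u v)"
    if uv: "u \<in> verts G" "v \<in> verts G" "u \<noteq> v" for u v
  proof -
    have B: "block_form G u v (ws u v) (k u v) (x u v) (y u v) (P u v)"
      and inv: "invertible_mat (P u v)"
      using assms(3,4) uv by blast+
    \<comment> \<open>The columns of \<open>u\<close> and \<open>v\<close> give the four equations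
      saying that the Schur complement inverts the block of \<open>g\<close> at
      \<open>u, v\<close>.\<close>
    note eqs = block_form_schur[OF B inv, of u] block_form_schur[OF B inv, of v]
    have "g u u = g v v \<longleftrightarrow>
      degree G u + 1 / real (card (verts G)) - x u v \<bullet> (the (mat_inverse (P u v)) *\<^sub>v x u v) =
      degree G v + 1 / real (card (verts G)) - y u v \<bullet> (the (mat_inverse (P u v)) *\<^sub>v y u v)"
      using eqs uv(3) green_commute[OF uv(1,2)]
      by (intro symmetric_inverse_diag_eq_iff) simp_all
    \<comment> \<open>The two terms \<open>1/n\<close> cancel.\<close>
    then show ?thesis
      by linarith
  qed
  then show ?thesis
    unfolding resistance_regular_iff_green_diag by blast
qed

end
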